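(* For every integer $n\ge 0$, \begin{align*} H_{5n}( G(x,5)) &=H_{5n+1}( G(x,5))=(2n+1)^2,\\ H_{5n+2}( G(x,5)) &=-\tfrac13 ( 50n^{2}+89n+39 )( 2n+1 ),\\ H_{5n+3}( G(x,5)) &=-16(n+1 )^2,\\ H_{5n+4}( G(x,5)) &=\tfrac13 ( 100n^{2}+272n+183 )( n+1 ). \end{align*}
   Context: For a power series $A(x)=\sum_{n\ge 0}a_nx^n$, the Hankel determinants are $H_n(A(x))=\det(a_{i+j})_{0\le i,j\le n-1}$ for $n\ge 1$, with $H_0(A(x))=1$. For a nonnegative integer $r$, $G(x,r)=\sum_{n\ge 0}\binom{2n+r}{n}x^n$; equivalently $G(x,r)=\frac{C(x)^r}{1-2xC(x)}=\frac{C(x)^r}{\sqrt{1-4x}}$, where $C(x)=\sum_{n\ge0}\frac1{n+1}\binom{2n}{n}x^n$. *)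

theory Defs
  imports
    "HOL-Computational_Algebra.Formal_Power_Series"
    "Jordan_Normal_Form.Determinant"
begin

definition hankel_det :: "nat \<Rightarrow> 'a :: comm_ring_1 fps \<Rightarrow> 'a" where
  "hankel_det n A = det (mat n n (\<lambda>(i, j). fps_nth A (i + j)))"

(* The determinant of the empty matrix is 1, so no separate clause for n = 0 is needed. *)
lemma hankel_det_0: "hankel_det 0 A = 1"
  by (simp add: hankel_det_def)

definition G :: "nat \<Rightarrow> rat fps" where
  "G r = Abs_fps (\<lambda>n. of_nat ((2 * n + r) choose n))"

end

theory Submission
  imports Defs
begin

text \<open>
  Write \<open>L\<close> for the linear functional on polynomials whose moments are the coefficients
  \<open>(2m+1) choose m\<close> of \<open>G 1\<close>. Its monic orthogonal polynomials are the
  shifted Chebyshev polynomials of the third kind, \<open>V\<^sub>l(4 cos\<^sup>2 \<theta>) = cos((2l+1)\<theta>) / cos \<theta>\<close>,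
  and they are even orthonormal, so that all Hankel determinants of \<open>G 1\<close> are 1.

  The coefficients of \<open>G 5\<close> are the moments of \<open>L\<close> multiplied by the quartic
  \<open>q = x\<^sup>2 (x\<^sup>2 - 5x + 5)\<close>, that is, \<open>(2m+5) choose m = L(q x\<^sup>m)\<close>
  (\<open>G5_eq_moment\<close>). Christoffel's theorem on multiplying a functional by a polynomial
  (\<open>christoffel\<close>) therefore turns the Hankel determinant of size \<open>n\<close> into the 4 by 4
  determinant of the coefficients of \<open>V\<^sub>n, ..., V\<^bsub>n+3\<^esub>\<close> modulo \<open>q\<close>.

  These residues are known explicitly (\<open>V_mod_5\<close>, \<open>V_mod_block\<close>). At the roots of
  \<open>x\<^sup>2 - 5x + 5\<close>, where \<open>2\<theta>\<close> is an odd multiple of \<open>\<pi>/5\<close>, the values of \<open>V\<^sub>l\<close>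
  change sign when \<open>l\<close> grows by 5. At the double root 0, \<open>V\<^sub>l\<close> and its derivative
  are, up to the sign \<open>(-1)\<^sup>l\<close>, polynomials of degree 1 and 3 in \<open>l\<close>. This is
  why the answer depends on \<open>n\<close> modulo 5 and is polynomial in each class.
\<close>

section \<open>Moment functionals\<close>

definition moment :: "'a::comm_ring_1 fps \<Rightarrow> 'a poly \<Rightarrow> 'a" where
  "moment A p = (\<Sum>i\<le>degree p. coeff p i * fps_nth A i)"

text \<open>A common summation range for polynomials of different degrees gives linearity.\<close>

lemma moment_eq_sum:
  assumes "degree p \<le> N"
  shows "moment A p = (\<Sum>i\<le>N. coeff p i * fps_nth A i)"
  unfolding moment_def
  by (rule sum.mono_neutral_left) (use assms in \<open>auto simp: coeff_eq_0\<close>)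

lemma moment_add: "moment A (p + q) = moment A p + moment A q"
proof -
  let ?N = "max (degree p) (degree q)"
  have "degree (p + q) \<le> ?N" by (rule degree_add_le_max)
  then show ?thesis
    by (simp add: moment_eq_sum[of _ ?N] sum.distrib algebra_simps)
qed

lemma moment_smult: "moment A (smult c p) = c * moment A p"
  by (simp add: moment_eq_sum[of _ "degree p"] degree_smult_le sum_distrib_left algebra_simps)

lemma moment_diff: "moment A (p - q) = moment A p - moment A q"
  using moment_add[of A p "smult (-1) q"] moment_smult[of A "-1" q] by simp

lemma moment_0 [simp]: "moment A 0 = 0"
  by (simp add: moment_def)

lemma moment_sum: "moment A (\<Sum>i\<in>I. f i) = (\<Sum>i\<in>I. moment A (f i))"
  by (induction I rule: infinite_finite_induct) (simp_all add: moment_add)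

lemma moment_monom: "moment A (monom 1 i) = fps_nth A i"
proof -
  have "moment A (monom 1 i) = (\<Sum>j\<le>i. coeff (monom 1 i) j * fps_nth A j)"
    by (rule moment_eq_sum) (simp add: degree_monom_le)
  also have "\<dots> = (\<Sum>j\<le>i. if j = i then fps_nth A i else 0)"
    by (rule sum.cong) auto
  finally show ?thesis by simp
qed

lemma sum_monom_lessThan:
  assumes "p = 0 \<or> degree p < k"
  shows "(\<Sum>j<k. monom (coeff p j) j) = p"
proof (rule poly_eqI)
  fix i
  have "coeff (\<Sum>j<k. monom (coeff p j) j) i = (if i < k then coeff p i else 0)"
    by (simp add: coeff_sum)
  then show "coeff (\<Sum>j<k. monom (coeff p j) j) i = coeff p i"
    using assms by (auto simp: coeff_eq_0)
qed

lemma moment_mult: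
  assumes "degree b \<le> N"
  shows "moment A (b * p) = (\<Sum>i\<le>N. coeff b i * moment A (monom 1 i * p))"
proof -
  have "b = (\<Sum>i\<le>N. monom (coeff b i) i)"
    using poly_as_sum_of_monoms'[OF assms] by simp
  then have "b * p = (\<Sum>i\<le>N. smult (coeff b i) (monom 1 i * p))"
    by (metis (no_types, lifting) mult_smult_left smult_monom mult.right_neutral
        sum.cong sum_distrib_right)
  then show ?thesis by (simp add: moment_sum moment_smult)
qed

section \<open>Christoffel's determinant for orthonormal monic polynomials\<close>

text \<open>
  Orthogonality is required only against monomials, which is the form in which it is checked by
  induction; \<open>moment_p_p\<close> recovers \<open>L(p\<^sub>i p\<^sub>j) = \<delta>\<^sub>i\<^sub>j\<close>. Polynomials that are monic and
  orthonormal at once exist exactly when all Hankel determinants of \<open>A\<close> are 1.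
\<close>

locale orthonormal_monic =
  fixes A :: "'a::field fps" and p :: "nat \<Rightarrow> 'a poly"
  assumes degree_p [simp]: "degree (p l) = l"
    and monic_p: "coeff (p l) l = 1"
    and moment_monom_p: "i \<le> l \<Longrightarrow> moment A (monom 1 i * p l) = (if i = l then 1 else 0)"
begin

lemma moment_mult_p:
  assumes "degree b \<le> l"
  shows "moment A (b * p l) = coeff b l"
proof -
  have "moment A (b * p l) = (\<Sum>i\<le>l. if i = l then coeff b l else 0)"
    unfolding moment_mult[OF assms] by (rule sum.cong) (auto simp: moment_monom_p)
  then show ?thesis by simp
qed

lemma moment_p_p: "moment A (p i * p j) = (if i = j then 1 else 0)"
proof (cases "i \<le> j")
  case True
  then show ?thesis by (auto simp: moment_mult_p monic_p coeff_eq_0)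
next
  case False
  then show ?thesis using moment_mult_p[of "p j" i] by (auto simp: mult.commute coeff_eq_0)
qed

text \<open>
  Passing from \<open>x\<^sup>l\<close> to \<open>p\<^sub>l\<close> in the columns multiplies the Hankel matrix by the unitriangular
  matrix of coefficients of the \<open>p\<^sub>l\<close>.
\<close>

lemma hankel_det_eq_det_moment:
  assumes B: "\<And>m. fps_nth B m = moment A (q * monom 1 m)"
  shows "hankel_det n B = det (mat n n (\<lambda>(i, l). moment A (q * monom 1 i * p l)))"
proof -
  define H where "H = mat n n (\<lambda>(i, j). fps_nth B (i + j))"
  define T where "T = mat n n (\<lambda>(i, l). coeff (p l) i)"
  have H: "H \<in> carrier_mat n n" and T: "T \<in> carrier_mat n n"
    by (auto simp: H_def T_def)
  have "det T = 1"
    by (subst det_upper_triangular[OF _ T])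
      (auto simp: T_def upper_triangular_def prod_list_diag_prod monic_p coeff_eq_0)
  moreover have "H * T = mat n n (\<lambda>(i, l). moment A (q * monom 1 i * p l))"
  proof (rule eq_matI, goal_cases)
    case (1 i l)
    then have il: "i < n" "l < n" by auto
    have "moment A (q * monom 1 i * p l) = moment A (p l * (q * monom 1 i))"
      by (simp add: ac_simps)
    also have "\<dots> = (\<Sum>j\<le>n-1. coeff (p l) j * moment A (monom 1 j * (q * monom 1 i)))"
      by (rule moment_mult) (use il in auto)
    also have "\<dots> = (\<Sum>j<n. coeff (p l) j * fps_nth B (i + j))"
      using il by (intro sum.cong) (auto simp: B ac_simps mult_monom)
    finally show ?case
      using il by (simp add: H_def T_def scalar_prod_def atLeast0LessThan mult.commute)
  qed (auto simp: H_def T_def)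
  ultimately show ?thesis
    using det_mult[OF H T] by (simp add: hankel_det_def H_def)
qed

text \<open>
  Besides the basis \<open>p\<^sub>0, ..., p\<^bsub>k+n-1\<^esub>\<close>, the polynomials of degree below \<open>k + n\<close> have
  the basis \<open>b = (1, x, ..., x\<^bsup>k-1\<^esup>, q, q x, ..., q x\<^bsup>n-1\<^esup>)\<close>. By orthonormality the
  matrix \<open>W\<close> of all \<open>L(b\<^sub>j p\<^sub>l)\<close> expresses \<open>b\<close> in terms of \<open>p\<close>, and is unitriangular.
  Conversely, division with remainder by \<open>q\<close> expresses \<open>p\<^sub>n, ..., p\<^bsub>n+k-1\<^esub>\<close> in terms of \<open>b\<close>,
  the first \<open>k\<close> coordinates being the coefficients of the remainder. The matrix \<open>X\<close> expresses
  \<open>q, ..., q x\<^bsup>n-1\<^esup>, p\<^sub>n, ..., p\<^bsub>n+k-1\<^esub>\<close> in terms of \<open>b\<close>, and \<open>Y = X W\<close> expresses the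
  same list in terms of \<open>p\<close>. Both are block triangular up to a swap of blocks, and equating their
  determinants gives the claim.
\<close>

theorem christoffel:
  fixes q :: "'a poly"
  assumes q: "degree q = k" "lead_coeff q = 1"
    and B: "\<And>m. fps_nth B m = moment A (q * monom 1 m)"
  shows "hankel_det n B =
    (-1) ^ (k * n) * det (mat k k (\<lambda>(a, j). coeff (p (n + a) mod q) j))"
proof -
  let ?N = "k + n"
  define b where "b j = (if j < k then monom 1 j else q * monom 1 (j - k))" for j
  define x where "x i j = (if i < n then if j = k + i then 1 else 0
    else if j < k then coeff (p i mod q) j else coeff (p i div q) (j - k))" for i j
  define X where "X = mat ?N ?N (\<lambda>(i, j). x i j)"
  define W where "W = mat ?N ?N (\<lambda>(j, l). moment A (b j * p l))"
  define Y where "Y = mat ?N ?N (\<lambda>(i, l). moment A ((if i < n then b (k + i) else p i) * p l))"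
  define R where "R = mat k k (\<lambda>(a, j). coeff (p (n + a) mod q) j)"
  define C where "C = mat n n (\<lambda>(i, l). moment A (q * monom 1 i * p l))"
  have q0: "q \<noteq> 0" using q by auto
  have carr: "X \<in> carrier_mat ?N ?N" "W \<in> carrier_mat ?N ?N" "Y \<in> carrier_mat ?N ?N"
    "R \<in> carrier_mat k k" "C \<in> carrier_mat n n"
    by (auto simp: X_def W_def Y_def R_def C_def)
  have degb: "degree (b j) = j" for j
    using q0 q by (auto simp: b_def degree_mult_eq degree_monom_eq)
  have lcb: "coeff (b j) j = 1" for j
  proof -
    have "lead_coeff (b j) = 1"
      using q by (simp add: b_def lead_coeff_mult degree_monom_eq)
    then show ?thesis by (simp add: degb)
  qed
  have "det W = 1"
    by (subst det_lower_triangular[OF _ carr(2)])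
      (auto simp: W_def prod_list_diag_prod moment_mult_p degb lcb coeff_eq_0)
  moreover have "X * W = Y"
  proof (rule eq_matI, goal_cases)
    case (1 i l)
    then have il: "i < ?N" "l < ?N" using carr by auto
    \<comment> \<open>Row \<open>i\<close> of \<open>X\<close> lists the coordinates in \<open>b\<close> of the polynomial on the right.\<close>
    have expand: "(\<Sum>j<?N. smult (x i j) (b j)) = (if i < n then b (k + i) else p i)"
    proof (cases "i < n")
      case True
      then have "(\<Sum>j<?N. smult (x i j) (b j)) = (\<Sum>j<?N. if j = k + i then b (k + i) else 0)"
        by (intro sum.cong) (auto simp: x_def)
      then show ?thesis using True by simp
    next
      case False
      have dr: "p i mod q = 0 \<or> degree (p i mod q) < k"
        using degree_mod_less[OF q0, of "p i"] q by auto
      have ds: "p i div q = 0 \<or> degree (p i div q) < n"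
      proof (cases "p i div q = 0")
        case nz: False
        have "degree (q * (p i div q)) \<le> ?N - 1"
          unfolding minus_mod_eq_mult_div[symmetric]
          by (rule degree_diff_le) (use il dr in auto)
        then show ?thesis
          using nz q0 q il by (simp add: degree_mult_eq)
      qed simp
      have "(\<Sum>j<?N. smult (x i j) (b j)) =
          (\<Sum>j<k. smult (x i j) (b j)) + (\<Sum>j<n. smult (x i (j + k)) (b (j + k)))"
        using sum.atLeastLessThan_concat[of 0 k ?N "\<lambda>j. smult (x i j) (b j)"]
          sum.shift_bounds_nat_ivl[of "\<lambda>j. smult (x i j) (b j)" 0 k n]
        by (simp add: atLeast0LessThan add.commute)
      also have "(\<Sum>j<k. smult (x i j) (b j)) = (\<Sum>j<k. monom (coeff (p i mod q) j) j)"
        using False by (intro sum.cong) (auto simp: x_def b_def smult_monom)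
      also have "\<dots> = p i mod q"
        by (rule sum_monom_lessThan[OF dr])
      also have "(\<Sum>j<n. smult (x i (j + k)) (b (j + k))) =
          q * (\<Sum>j<n. monom (coeff (p i div q) j) j)"
        using False by (simp add: x_def b_def sum_distrib_left smult_monom flip: mult_smult_right)
      also have "\<dots> = q * (p i div q)"
        by (simp add: sum_monom_lessThan[OF ds])
      finally show ?thesis using False by simp
    qed
    have "(X * W) $$ (i, l) = (\<Sum>j<?N. x i j * moment A (b j * p l))"
      using il by (simp add: X_def W_def scalar_prod_def atLeast0LessThan)
    also have "\<dots> = moment A ((\<Sum>j<?N. smult (x i j) (b j)) * p l)"
      by (simp add: sum_distrib_right moment_sum moment_smult)
    finally show ?case unfolding expand using il by (simp add: Y_def)
  qed (use carr in auto)
  ultimately have "det X = det Y"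
    using det_mult[OF carr(1,2)] by simp
  have "det X = (-1) ^ (k * n) * det R"
  proof -
    have "det X = (-1) ^ (k * n) * det (mat ?N ?N (\<lambda>(i, j). X $$ (if i < k then i + n else i - k, j)))"
      by (rule det_swap_rows[OF carr(1)])
    also have "mat ?N ?N (\<lambda>(i, j). X $$ (if i < k then i + n else i - k, j)) =
        four_block_mat R (mat k n (\<lambda>(a, j). coeff (p (n + a) div q) j)) (0\<^sub>m n k) (1\<^sub>m n)"
      by (rule eq_matI) (auto simp: X_def R_def x_def add.commute)
    also have "det \<dots> = det R * det (1\<^sub>m n)"
      by (rule det_four_block_mat_lower_left_zero) (auto simp: R_def)
    finally show ?thesis by simp
  qed
  moreover have "det Y = det C"
  proof -
    have "Y = four_block_mat C (mat n k (\<lambda>(i, a). moment A (q * monom 1 i * p (n + a))))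
        (0\<^sub>m k n) (1\<^sub>m k)"
      by (rule eq_matI) (auto simp: Y_def C_def b_def moment_p_p)
    also have "det \<dots> = det C * det (1\<^sub>m k)"
      by (rule det_four_block_mat_lower_left_zero) (auto simp: C_def)
    finally show ?thesis by simp
  qed
  ultimately show ?thesis
    using hankel_det_eq_det_moment[OF B, of n] \<open>det X = det Y\<close>
    by (simp add: C_def R_def)
qed

end


section \<open>Small determinants\<close>

lemma det_mat_Suc:
  "det (mat (Suc n) (Suc n) f) = (\<Sum>j<Suc n. (-1) ^ j * f (0, j) *
    det (mat n n (\<lambda>(i, l). f (Suc i, if l < j then l else Suc l))))"
proof -
  have "mat_delete (mat (Suc n) (Suc n) f) 0 j =
      mat n n (\<lambda>(i, l). f (Suc i, if l < j then l else Suc l))" if "j < Suc n" for j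
    using that by (intro eq_matI) (auto simp: mat_delete_def)
  then show ?thesis
    by (subst laplace_expansion_row[of _ "Suc n" 0])
      (auto simp: cofactor_def intro!: sum.cong)
qed

lemma det_mat_3: "det (mat 3 3 f) =
    f (0, 0) * (f (1, 1) * f (2, 2) - f (1, 2) * f (2, 1))
  - f (0, 1) * (f (1, 0) * f (2, 2) - f (1, 2) * f (2, 0))
  + f (0, 2) * (f (1, 0) * f (2, 1) - f (1, 1) * f (2, 0))"
  unfolding numeral_3_eq_3 det_mat_Suc by (simp add: lessThan_Suc numeral_2_eq_2)

lemma det_mat_4: "det (mat 4 4 f) =
    f (0, 0) * det (mat 3 3 (\<lambda>(i, j). f (Suc i, Suc j)))
  - f (0, 1) * det (mat 3 3 (\<lambda>(i, j). f (Suc i, if j < 1 then j else Suc j)))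
  + f (0, 2) * det (mat 3 3 (\<lambda>(i, j). f (Suc i, if j < 2 then j else Suc j)))
  - f (0, 3) * det (mat 3 3 (\<lambda>(i, j). f (Suc i, if j < 3 then j else Suc j)))"
proof -
  have "det (mat 4 4 f) = det (mat (Suc 3) (Suc 3) f)" by simp
  then show ?thesis
    unfolding det_mat_Suc by (simp add: lessThan_Suc numeral_2_eq_2 numeral_3_eq_3)
qed

section \<open>The orthonormal polynomials of G 1\<close>

text \<open>
  The recurrence is \<open>cos((2n+5)\<theta>) = 2 cos(2\<theta>) cos((2n+3)\<theta>) - cos((2n+1)\<theta>)\<close> divided by
  \<open>cos \<theta>\<close>, with \<open>2 cos(2\<theta>) = x - 2\<close> for \<open>x = 4 cos\<^sup>2 \<theta>\<close>.
\<close>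

fun V :: "nat \<Rightarrow> rat poly" where
  "V 0 = 1"
| "V (Suc 0) = [:-3, 1:]"
| "V (Suc (Suc n)) = [:-2, 1:] * V (Suc n) - V n"

\<comment> \<open>Indices \<open>Suc (Suc ...)\<close> below must not unfold the recurrence.\<close>
declare V.simps(3) [simp del]

lemma degree_lead_coeff_V: "degree (V l) = l \<and> coeff (V l) l = 1"
proof (induction l rule: V.induct)
  case (3 n)
  let ?p = "[:-2, 1:] * V (Suc n)"
  have "V (Suc n) \<noteq> 0" using 3 by force
  then have deg: "degree ?p = Suc (Suc n)"
    using 3 by (subst degree_mult_eq) auto
  have "degree (?p + - V n) = degree ?p"
    by (rule degree_add_eq_left) (use 3 deg in simp)
  moreover have "lead_coeff ?p = 1"
    unfolding lead_coeff_mult using 3 by simp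
  moreover have "coeff (V n) (Suc (Suc n)) = 0"
    using 3 by (simp add: coeff_eq_0)
  ultimately show ?case
    by (simp add: deg V.simps(3) del: mult_pCons_left)
qed auto

text \<open>
  Pascal's rule used twice; a factor \<open>x\<close> under the moment functional raises the upper index
  \<open>2 i + 1\<close> by 2.
\<close>

lemma choose_add_2:
  "(n + 2) choose (k + 2) = (n choose k) + 2 * (n choose (k + 1)) + (n choose (k + 2))"
  by (simp add: eval_nat_numeral)

text \<open>
  The binomial coefficient vanishes for \<open>i < l\<close> and is 1 for \<open>i = l\<close>, so this closed form contains
  orthonormality. The lower index \<open>i + l + 1\<close> (rather than the symmetric \<open>i - l\<close>) avoids truncated
  subtraction, and the recurrence of \<open>V\<close> becomes exactly \<open>choose_add_2\<close>.
\<close>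

lemma moment_G1_V: "moment (G 1) (monom 1 i * V l) = of_nat ((2 * i + 1) choose (i + l + 1))"
proof (induction l arbitrary: i rule: V.induct)
  case 1
  have "(2 * i + 1) choose i = (2 * i + 1) choose (i + 1)"
    using binomial_symmetric[of i "2 * i + 1"] by simp
  then show ?case by (simp add: moment_monom G_def)
next
  case 2
  have sym1: "(2 * i + 1) choose i = (2 * i + 1) choose (i + 1)"
    using binomial_symmetric[of i "2 * i + 1"] by (simp del: binomial_Suc_Suc)
  have sym2: "(2 * i + 1 + 2) choose (i + 1) = (2 * i + 1 + 2) choose (i + 2)"
    using binomial_symmetric[of "i + 1" "2 * i + 1 + 2"] by (simp del: binomial_Suc_Suc)
  have "monom 1 i * V (Suc 0) = monom 1 (Suc i) - smult 3 (monom 1 i)"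
    by (simp add: monom_Suc mult.commute[of "monom 1 i"])
  then have "moment (G 1) (monom 1 i * V (Suc 0)) =
      of_nat ((2 * i + 1 + 2) choose (i + 1)) - 3 * of_nat ((2 * i + 1) choose i)"
    by (simp add: moment_diff moment_smult moment_monom G_def del: binomial_Suc_Suc)
  also have "\<dots> = of_nat ((2 * i + 1) choose (i + 2))"
    unfolding sym2 choose_add_2 sym1 by (simp del: binomial_Suc_Suc)
  finally show ?case by simp
next
  case (3 n)
  have "monom 1 i * V (Suc (Suc n)) =
      monom 1 (Suc i) * V (Suc n) - smult 2 (monom 1 i * V (Suc n)) - monom 1 i * V n"
    by (simp add: V.simps(3) monom_Suc algebra_simps)
  then have "moment (G 1) (monom 1 i * V (Suc (Suc n))) =
      of_nat ((2 * i + 1 + 2) choose (i + n + 1 + 2))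
      - 2 * of_nat ((2 * i + 1) choose (i + n + 1 + 1))
      - of_nat ((2 * i + 1) choose (i + n + 1))"
    using 3 by (simp add: moment_diff moment_smult del: binomial_Suc_Suc)
  also have "\<dots> = of_nat ((2 * i + 1) choose (i + Suc (Suc n) + 1))"
    unfolding choose_add_2 by (simp del: binomial_Suc_Suc)
  finally show ?case .
qed

interpretation V: orthonormal_monic "G 1" V
  by unfold_locales (auto simp: degree_lead_coeff_V moment_G1_V mult_2 simp del: One_nat_def)

section \<open>Reduction to determinants of size four\<close>

text \<open>
  The factor relating the weights of \<open>G 1\<close> and \<open>G 5\<close>: with \<open>y = 2 cos \<theta>\<close> and \<open>x = y\<^sup>2\<close>, the
  coefficient \<open>(2m+r) choose m\<close> is the mean of \<open>y\<^bsup>2m+r\<^esup> cos(r \<theta>)\<close> over the circle, and \<open>q(x)\<close> is the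
  quotient of \<open>y\<^sup>5 cos(5 \<theta>)\<close> by \<open>y cos \<theta>\<close>.
\<close>

abbreviation q :: "rat poly" where "q \<equiv> [:0, 0, 5, -5, 1:]"

text \<open>
  Expanding all binomial coefficients down to the row \<open>2 m + 5\<close> leaves their alternating sum over
  the lower indices \<open>m, ..., m + 4\<close>, where all but the first cancel by symmetry.
\<close>

lemma G5_eq_moment: "fps_nth (G 5) m = moment (G 1) (q * monom 1 m)"
proof -
  have sym: "(2 * m + 5) choose (m + 3) = (2 * m + 5) choose (m + 2)"
    "(2 * m + 5) choose (m + 4) = (2 * m + 5) choose (m + 1)"
    using binomial_symmetric[of "m + 2" "2 * m + 5"] binomial_symmetric[of "m + 1" "2 * m + 5"]
    by (simp_all add: add.commute)
  have idx: "m + 3 = Suc (Suc (Suc m))" "m + 4 = Suc (Suc (Suc (Suc m)))"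
    by simp_all
  have "moment (G 1) (q * monom 1 m) = 
     (\<Sum>i\<le>4. coeff q i * moment (G 1) (monom 1 i * monom 1 m))"
    by (rule moment_mult) simp
  also have "\<dots> = 5 * of_nat ((2 * m + 5) choose (m + 2)) - 5 * of_nat ((2 * m + 7) choose (m + 3))
    + of_nat ((2 * m + 9) choose (m + 4))"
    by (simp add: eval_nat_numeral mult_monom moment_monom G_def)
  also have "(2 * m + 9) choose (m + 4) = (2 * m + 5 + 2 + 2) choose (m + 2 + 2)"
    by (rule arg_cong2[of _ _ _ _ binomial]) simp_all
  also have "(2 * m + 7) choose (m + 3) = (2 * m + 5 + 2) choose (m + 1 + 2)"
    by (rule arg_cong2[of _ _ _ _ binomial]) simp_all
  also have "(2 * m + 5 + 2 + 2) choose (m + 2 + 2) =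
      ((2 * m + 5) choose m) + 4 * ((2 * m + 5) choose (m + 1)) + 6 * ((2 * m + 5) choose (m + 2))
      + 4 * ((2 * m + 5) choose (m + 3)) + ((2 * m + 5) choose (m + 4))"
    using choose_add_2[of "2 * m + 5" m] choose_add_2[of "2 * m + 5" "m + 1"]
      choose_add_2[of "2 * m + 5" "m + 2"] choose_add_2[of "2 * m + 5 + 2" "m + 2"]
    by (simp add: add.assoc idx)
  also have "(2 * m + 5 + 2) choose (m + 1 + 2) =
      ((2 * m + 5) choose (m + 1)) + 2 * ((2 * m + 5) choose (m + 2)) + ((2 * m + 5) choose (m + 3))"
    using choose_add_2[of "2 * m + 5" "m + 1"] by (simp add: add.assoc idx)
  finally show ?thesis unfolding sym by (simp add: G_def)
qed

lemma hankel_det_G5: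
  "hankel_det n (G 5) = det (mat 4 4 (\<lambda>(a, j). coeff (V (n + a) mod q) j))"
  using V.christoffel[of q 4 "G 5" n] G5_eq_moment by simp

section \<open>Residues modulo the quartic\<close>

text \<open>
  Polynomials of degree at most 3 are written in the basis \<open>1, x, t, x t\<close> with
  \<open>t = x\<^sup>2 - 5x + 5\<close>. Multiplication by \<open>x\<close> modulo \<open>q = x\<^sup>2 t\<close> is sparse there: it sends \<open>x\<close> to
  \<open>t + 5 x - 5\<close> and \<open>x t\<close> to 0. The coordinates \<open>u, w\<close> determine the residue modulo \<open>t\<close>.
\<close>

definition residue :: "rat \<Rightarrow> rat \<Rightarrow> rat \<Rightarrow> rat \<Rightarrow> rat poly" where
  "residue u w \<alpha> \<beta> = [:u, w:] + [:5, -5, 1:] * [:\<alpha>, \<beta>:]"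

lemma residue_eq:
  "residue u w \<alpha> \<beta> = [:u + 5 * \<alpha>, w - 5 * \<alpha> + 5 * \<beta>, \<alpha> - 5 * \<beta>, \<beta>:]"
  by (simp add: residue_def)

lemma V_mod_step:
  assumes "V n mod q = smult s (residue u0 w0 \<alpha>0 \<beta>0)"
    and "V (Suc n) mod q = smult s (residue u1 w1 \<alpha>1 \<beta>1)"
    and r: "u2 = - 5*w1 - 2*u1 - u0" "w2 = u1 + 3*w1 - w0"
      "\<alpha>2 = w1 - 2*\<alpha>1 - \<alpha>0" "\<beta>2 = \<alpha>1 - 2*\<beta>1 - \<beta>0"
  shows "V (Suc (Suc n)) mod q = smult s (residue u2 w2 \<alpha>2 \<beta>2)"
proof -
  have "V (Suc (Suc n)) mod q = ([:-2, 1:] * (V (Suc n) mod q) - V n mod q) mod q"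
    unfolding V.simps by (intro mod_diff_cong) (simp_all only: mod_mult_right_eq mod_mod_trivial)
  \<comment> \<open>The coefficient of \<open>x\<^sup>4\<close> is the multiple of \<open>q\<close> that has to be removed.\<close>
  also have "\<dots> = (smult s (residue u2 w2 \<alpha>2 \<beta>2) + [:s * \<beta>1:] * q) mod q"
    unfolding assms(1,2) r residue_eq
    by (rule arg_cong[of _ _ "\<lambda>p. p mod q"]) (simp add: algebra_simps)
  also have "\<dots> = smult s (residue u2 w2 \<alpha>2 \<beta>2) mod q" by (rule mod_mult_self1)
  also have "\<dots> = smult s (residue u2 w2 \<alpha>2 \<beta>2)" by (rule mod_poly_less) (simp add: residue_eq)
  finally show ?thesis .
qed

text \<open>
  One period of the residues, where \<open>M\<close> stands for the number of completed periods. The list runs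
  over eight consecutive indices because the determinant for the last class reaches three indices
  into the next period, whose entries are the first ones at \<open>M + 1\<close> with opposite sign.
  The last two coordinates are found from \<open>V\<^sub>l = (-1)\<^sup>l ((2l+1) - l(l+1)(2l+1)/6 x)\<close> modulo
  \<open>x\<^sup>2\<close>, with \<open>l = 5 M, 5 M + 1, ...\<close>; hence one of them is linear and the other cubic in \<open>M\<close>.
\<close>

lemma V_mod_block:
  assumes P0: "V n mod q = smult s (residue 1 0 (2*M) (-(50*M^3 + 15*M^2 - 11*M) / 6))"
    and P1: "V (Suc n) mod q = smult s (residue (-3) 1 (-2*M) ((50*M^3 + 45*M^2 + M) / 6))"
  shows "V (Suc (Suc n)) mod q = smult s (residue 0 0 (2*M + 1) (-(50*M^3 + 75*M^2 + 25*M) / 6))"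
    and "V (Suc (Suc (Suc n))) mod q =
      smult s (residue 3 (-1) (-2*M - 2) ((50*M^3 + 105*M^2 + 61*M + 6) / 6))"
    and "V (Suc (Suc (Suc (Suc n)))) mod q =
      smult s (residue (-1) 0 (2*M + 2) (-(50*M^3 + 135*M^2 + 109*M + 24) / 6))"
    and "V (Suc (Suc (Suc (Suc (Suc n))))) mod q =
      smult s (residue (-1) 0 (-2*(M+1)) ((50*(M+1)^3 + 15*(M+1)^2 - 11*(M+1)) / 6))"
    and "V (Suc (Suc (Suc (Suc (Suc (Suc n)))))) mod q =
      smult s (residue 3 (-1) (2*(M+1)) (-(50*(M+1)^3 + 45*(M+1)^2 + (M+1)) / 6))"
    and "V (Suc (Suc (Suc (Suc (Suc (Suc (Suc n))))))) mod q =
      smult s (residue 0 0 (-2*(M+1) - 1) ((50*(M+1)^3 + 75*(M+1)^2 + 25*(M+1)) / 6))"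
    (is ?P7)
proof -
  note simps = field_simps power2_eq_square power3_eq_cube
  show P2: "V (Suc (Suc n)) mod q =
      smult s (residue 0 0 (2*M + 1) (-(50*M^3 + 75*M^2 + 25*M) / 6))"
    by (rule V_mod_step[OF P0 P1]) (simp_all add: simps)
  show P3: "V (Suc (Suc (Suc n))) mod q =
      smult s (residue 3 (-1) (-2*M - 2) ((50*M^3 + 105*M^2 + 61*M + 6) / 6))"
    by (rule V_mod_step[OF P1 P2]) (simp_all add: simps)
  show P4: "V (Suc (Suc (Suc (Suc n)))) mod q =
      smult s (residue (-1) 0 (2*M + 2) (-(50*M^3 + 135*M^2 + 109*M + 24) / 6))"
    by (rule V_mod_step[OF P2 P3]) (simp_all add: simps)
  show P5: "V (Suc (Suc (Suc (Suc (Suc n))))) mod q =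
      smult s (residue (-1) 0 (-2*(M+1)) ((50*(M+1)^3 + 15*(M+1)^2 - 11*(M+1)) / 6))"
    by (rule V_mod_step[OF P3 P4]) (simp_all add: simps)
  show P6: "V (Suc (Suc (Suc (Suc (Suc (Suc n)))))) mod q =
      smult s (residue 3 (-1) (2*(M+1)) (-(50*(M+1)^3 + 45*(M+1)^2 + (M+1)) / 6))"
    by (rule V_mod_step[OF P4 P5]) (simp_all add: simps)
  show ?P7
    by (rule V_mod_step[OF P5 P6]) (simp_all add: simps)
qed

lemma smult_residue: "smult c (residue u w \<alpha> \<beta>) = residue (c * u) (c * w) (c * \<alpha>) (c * \<beta>)"
  by (simp add: residue_eq algebra_simps)

lemma V_mod_5:
  "V (5*m) mod q = smult ((-1)^m)
     (residue 1 0 (2 * of_nat m) (-(50 * of_nat m^3 + 15 * of_nat m^2 - 11 * of_nat m) / 6))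
  \<and> V (Suc (5*m)) mod q = smult ((-1)^m)
     (residue (-3) 1 (-2 * of_nat m) ((50 * of_nat m^3 + 45 * of_nat m^2 + of_nat m) / 6))"
proof (induction m)
  case 0
  show ?case by (simp add: residue_eq mod_poly_less)
next
  case (Suc m)
  have five: "5 * Suc m = Suc (Suc (Suc (Suc (Suc (5 * m)))))" by simp
  note block = V_mod_block[OF conjunct1[OF Suc.IH] conjunct2[OF Suc.IH]]
  show ?case
    unfolding five
    by (intro conjI; rule block(4)[THEN trans] block(5)[THEN trans])
      (simp_all add: smult_residue algebra_simps)
qed

section \<open>The Hankel determinants of G 5\<close>

text \<open>
  The change of basis from \<open>1, x, t, x t\<close> to the monomials (the matrix \<open>T\<close>) is unitriangular, so
  the determinant may be computed from the sparser coordinates of the residues; four rows with the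
  same sign contribute \<open>s\<^sup>4 = 1\<close>.
\<close>

lemma hankel_det_G5_rows:
  assumes r: "V n mod q = smult s (residue a0 b0 c0 d0)"
      "V (Suc n) mod q = smult s (residue a1 b1 c1 d1)"
      "V (Suc (Suc n)) mod q = smult s (residue a2 b2 c2 d2)"
      "V (Suc (Suc (Suc n))) mod q = smult s (residue a3 b3 c3 d3)"
    and s: "s ^ 2 = 1"
  shows "hankel_det n (G 5) =
    a0 * (b1 * (c2 * d3 - d2 * c3) - c1 * (b2 * d3 - d2 * b3) + d1 * (b2 * c3 - c2 * b3))
  - b0 * (a1 * (c2 * d3 - d2 * c3) - c1 * (a2 * d3 - d2 * a3) + d1 * (a2 * c3 - c2 * a3))
  + c0 * (a1 * (b2 * d3 - d2 * b3) - b1 * (a2 * d3 - d2 * a3) + d1 * (a2 * b3 - b2 * a3))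
  - d0 * (a1 * (b2 * c3 - c2 * b3) - b1 * (a2 * c3 - c2 * a3) + c1 * (a2 * b3 - b2 * a3))"
proof -
  define R where "R = mat 4 4 (\<lambda>(a, j). coeff (V (n + a) mod q) j)"
  define K where "K = mat 4 4 (\<lambda>(a, i).
    [[a0, b0, c0, d0], [a1, b1, c1, d1], [a2, b2, c2, d2], [a3, b3, c3, d3]] ! a ! i)"
  define T where "T = mat 4 4 (\<lambda>(i, j).
    [[1, 0, 0, 0], [0, 1, 0, 0], [5, - 5, 1, 0], [0, 5, - 5, 1 :: rat]] ! i ! j)"
  have K: "K \<in> carrier_mat 4 4" and T: "T \<in> carrier_mat 4 4"
    by (auto simp: K_def T_def)
  have less4: "i < 4 \<longleftrightarrow> i = 0 \<or> i = 1 \<or> i = 2 \<or> i = 3" for i :: nat by auto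
  have "R = s \<cdot>\<^sub>m (K * T)"
  proof (rule eq_matI, goal_cases)
    case (1 a j)
    then have "a < 4" "j < 4" by (auto simp: K_def T_def)
    then show ?case
      unfolding less4
      by (elim disjE)
        (simp_all add: R_def K_def T_def scalar_prod_def r residue_eq eval_nat_numeral algebra_simps)
  qed (auto simp: R_def K_def T_def)
  moreover have "det T = 1"
    by (simp add: T_def det_mat_4 det_mat_3)
  moreover have "s ^ 4 = 1"
    using s power_mult[of s 2 2] by simp
  ultimately have "hankel_det n (G 5) = det K"
    using det_mult[OF K T] T by (simp add: hankel_det_G5 R_def det_smult)
  then show ?thesis
    by (simp add: K_def det_mat_4 det_mat_3)
qed

theorem theorem15:
  fixes n :: nat
  shows "hankel_det (5 * n) (G 5) = (2 * of_nat n + 1) ^ 2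
    \<and> hankel_det (5 * n + 1) (G 5) = (2 * of_nat n + 1) ^ 2
    \<and> hankel_det (5 * n + 2) (G 5)
        = - (1 / 3) * (50 * of_nat n ^ 2 + 89 * of_nat n + 39) * (2 * of_nat n + 1)
    \<and> hankel_det (5 * n + 3) (G 5) = - 16 * (of_nat n + 1) ^ 2
    \<and> hankel_det (5 * n + 4) (G 5)
        = (1 / 3) * (100 * of_nat n ^ 2 + 272 * of_nat n + 183) * (of_nat n + 1)"
proof -
  define s M where "s = (- 1 :: rat) ^ n" and "M = rat_of_nat n"
  have s: "s ^ 2 = 1" by (simp add: s_def flip: power_mult_distrib power_mult)
  have P0: "V (5*n) mod q = smult s (residue 1 0 (2*M) (-(50*M^3 + 15*M^2 - 11*M) / 6))"
    and P1: "V (Suc (5*n)) mod q = smult s (residue (-3) 1 (-2*M) ((50*M^3 + 45*M^2 + M) / 6))"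
    using V_mod_5[of n] by (simp_all add: s_def M_def)
  note P = P0 P1 V_mod_block[OF P0 P1]
  note simps = field_simps power2_eq_square power3_eq_cube
  have "hankel_det (5 * n) (G 5) = (2 * M + 1) ^ 2"
    unfolding hankel_det_G5_rows[OF P(1-4) s] by (simp add: simps)
  moreover have "hankel_det (Suc (5 * n)) (G 5) = (2 * M + 1) ^ 2"
    unfolding hankel_det_G5_rows[OF P(2-5) s] by (simp add: simps)
  moreover have "hankel_det (Suc (Suc (5 * n))) (G 5) =
      - (1 / 3) * (50 * M ^ 2 + 89 * M + 39) * (2 * M + 1)"
    unfolding hankel_det_G5_rows[OF P(3-6) s] by (simp add: simps)
  moreover have "hankel_det (Suc (Suc (Suc (5 * n)))) (G 5) = - 16 * (M + 1) ^ 2"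
    unfolding hankel_det_G5_rows[OF P(4-7) s] by (simp add: simps)
  moreover have "hankel_det (Suc (Suc (Suc (Suc (5 * n))))) (G 5) =
      (1 / 3) * (100 * M ^ 2 + 272 * M + 183) * (M + 1)"
    unfolding hankel_det_G5_rows[OF P(5-8) s] by (simp add: simps)
  moreover have idx: "5 * n + 1 = Suc (5 * n)" "5 * n + 2 = Suc (Suc (5 * n))"
    "5 * n + 3 = Suc (Suc (Suc (5 * n)))" "5 * n + 4 = Suc (Suc (Suc (Suc (5 * n))))"
    by simp_all
  ultimately show ?thesis
    unfolding idx M_def by (intro conjI)
qed

end
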